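(* Let $\mathbf{sVir}$ be a super Virasoro algebra over $\mathbb{C}$ (either the Ramond or the Neveu–Schwarz algebra). Then there are no non-trivial transposed Poisson superalgebra structures defined on $\mathbf{sVir}$.
   Context: $\mathbf{sVir}$ is the complex Lie superalgebra with basis of even elements $\{L_m\}_{m\in\mathbb{Z}}\cup\{c\}$ and odd elements $\{G_r\}_{r\in i+\mathbb{Z}}$, where $i=0$ (Ramond case) or $i=\frac12$ (Neveu–Schwarz case), $c$ is central, and $[L_m,L_n]=(m-n)L_{m+n}+\frac{m^3-m}{12}\delta_{m+n,0}\,c$, $[L_m,G_r]=\left(\frac m2-r\right)G_{m+r}$, $[G_r,G_s]=2L_{r+s}+\frac c3\left(r^2-\frac14\right)\delta_{r+s,0}$. A transposed Poisson superalgebra structure on a complex Lie superalgebra $(\mathfrak{L}=\mathfrak{L}_0\oplus\mathfrak{L}_1,[\;,\;])$ is a bilinear operation $\cdot$ on $\mathfrak{L}$, compatible with the $\mathbb{Z}_2$-grading, such that $(\mathfrak{L},\cdot)$ is a supercommutative associative superalgebra (not necessarily unital) and $2z\cdot[x,y]=[z\cdot x,y]+(-1)^{|x||z|}[x,z\cdot y]$ for all homogeneous $x,y,z$, where $|x|$ is the parity of $x$. The structure is non-trivial if both operations $\cdot$ and $[\;,\;]$ are not identically zero. *)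

theory Defs
  imports Complex_Main "HOL-Library.Z2" "HOL-Library.Poly_Mapping"
begin

section \<open>Transposed Poisson superalgebras\<close>

text \<open>The parities are the elements of \<^typ>\<open>bit\<close>, the field with two elements.\<close>

locale superspace = vector_space scale
  for scale :: "complex \<Rightarrow> 'v::ab_group_add \<Rightarrow> 'v" +
  fixes part :: "bit \<Rightarrow> 'v set"
  assumes subspace_part: "subspace (part p)"
    and part_inter: "part 0 \<inter> part 1 = {0}"
    and part_sum: "\<exists>x\<in>part 0. \<exists>y\<in>part 1. v = x + y"

locale superalgebra = superspace scale part
  for scale :: "complex \<Rightarrow> 'v::ab_group_add \<Rightarrow> 'v" and part :: "bit \<Rightarrow> 'v set" +
  fixes mul :: "'v \<Rightarrow> 'v \<Rightarrow> 'v"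
  assumes linear_right: "Vector_Spaces.linear scale scale (mul x)"
    and linear_left: "Vector_Spaces.linear scale scale (\<lambda>x. mul x y)"
    and graded: "x \<in> part p \<Longrightarrow> y \<in> part q \<Longrightarrow> mul x y \<in> part (p + q)"

text \<open>The sign \<open>(-1)\<^bsup>pq\<^esup>\<close>.\<close>

definition koszul_sign :: "bit \<Rightarrow> bit \<Rightarrow> complex" where
  "koszul_sign p q = (if p * q = 1 then - 1 else 1)"

locale lie_superalgebra = superalgebra scale part bracket
  for scale :: "complex \<Rightarrow> 'v::ab_group_add \<Rightarrow> 'v" and part :: "bit \<Rightarrow> 'v set"
    and bracket :: "'v \<Rightarrow> 'v \<Rightarrow> 'v" +
  assumes super_skew: "x \<in> part p \<Longrightarrow> y \<in> part q \<Longrightarrow>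
      bracket x y = - scale (koszul_sign p q) (bracket y x)"
    and super_jacobi: "x \<in> part p \<Longrightarrow> y \<in> part q \<Longrightarrow> z \<in> part r \<Longrightarrow>
      bracket x (bracket y z) =
        bracket (bracket x y) z + scale (koszul_sign p q) (bracket y (bracket x z))"

locale supercommutative_associative_superalgebra = superalgebra scale part mult
  for scale :: "complex \<Rightarrow> 'v::ab_group_add \<Rightarrow> 'v" and part :: "bit \<Rightarrow> 'v set"
    and mult :: "'v \<Rightarrow> 'v \<Rightarrow> 'v" +
  assumes mult_assoc: "mult (mult x y) z = mult x (mult y z)"
    and super_comm: "x \<in> part p \<Longrightarrow> y \<in> part q \<Longrightarrow>
      mult x y = scale (koszul_sign p q) (mult y x)"

locale transposed_poisson_superalgebra =
  lie: lie_superalgebra scale part bracket +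
  prod: supercommutative_associative_superalgebra scale part mult
  for scale :: "complex \<Rightarrow> 'v::ab_group_add \<Rightarrow> 'v" and part :: "bit \<Rightarrow> 'v set"
    and bracket :: "'v \<Rightarrow> 'v \<Rightarrow> 'v" and mult :: "'v \<Rightarrow> 'v \<Rightarrow> 'v" +
  assumes transposed_leibniz: "x \<in> part p \<Longrightarrow> y \<in> part q \<Longrightarrow> z \<in> part r \<Longrightarrow>
      scale 2 (mult z (bracket x y)) =
        bracket (mult z x) y + scale (koszul_sign p r) (bracket x (mult z y))"

definition nontrivial_structure :: "('v::zero \<Rightarrow> 'v \<Rightarrow> 'v) \<Rightarrow> ('v \<Rightarrow> 'v \<Rightarrow> 'v) \<Rightarrow> bool" where
  "nontrivial_structure bracket mult \<longleftrightarrow>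
    (\<exists>x y. mult x y \<noteq> 0) \<and> (\<exists>x y. bracket x y \<noteq> 0)"

section \<open>The super Virasoro algebras\<close>

datatype sector = Ramond | Neveu_Schwarz

text \<open>\<open>twice_offset\<close> is \<open>2i\<close>, where the odd generators are indexed by \<open>i + \<int>\<close>.\<close>

fun twice_offset :: "sector \<Rightarrow> int" where
  "twice_offset Ramond = 0"
| "twice_offset Neveu_Schwarz = 1"

text \<open>The index \<open>G k\<close> stands for the odd generator \<open>G\<^sub>r\<close> with \<open>r = k + i\<close>.\<close>

datatype svir_index = L int | C | G int

definition mode :: "sector \<Rightarrow> int \<Rightarrow> complex" where
  "mode s k = of_int k + of_int (twice_offset s) / 2"

type_synonym svir = "svir_index \<Rightarrow>\<^sub>0 complex"

definition svir_scale :: "complex \<Rightarrow> svir \<Rightarrow> svir" where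
  "svir_scale a = Poly_Mapping.map ((*) a)"

definition svir_basis :: "svir_index \<Rightarrow> svir" where
  "svir_basis i = Poly_Mapping.single i 1"

fun parity :: "svir_index \<Rightarrow> bit" where
  "parity (L m) = 0"
| "parity C = 0"
| "parity (G k) = 1"

definition svir_part :: "bit \<Rightarrow> svir set" where
  "svir_part p = {x. \<forall>i \<in> Poly_Mapping.keys x. parity i = p}"

text \<open>For \<open>r = k + i\<close> and \<open>s = l + i\<close> one has \<open>r + s = k + l + 2i\<close>.\<close>

fun basis_bracket :: "sector \<Rightarrow> svir_index \<Rightarrow> svir_index \<Rightarrow> svir" where
  "basis_bracket s (L m) (L n) =
     svir_scale (of_int (m - n)) (svir_basis (L (m + n))) +
     svir_scale (if m + n = 0 then of_int (m ^ 3 - m) / 12 else 0) (svir_basis C)"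
| "basis_bracket s (L m) (G k) =
     svir_scale (of_int m / 2 - mode s k) (svir_basis (G (m + k)))"
| "basis_bracket s (G k) (L m) =
     - svir_scale (of_int m / 2 - mode s k) (svir_basis (G (m + k)))"
| "basis_bracket s (G k) (G l) =
     svir_scale 2 (svir_basis (L (k + l + twice_offset s))) +
     svir_scale (if k + l + twice_offset s = 0 then ((mode s k)\<^sup>2 - 1 / 4) / 3 else 0)
       (svir_basis C)"
| "basis_bracket s C j = 0"
| "basis_bracket s i C = 0"

definition svir_bracket :: "sector \<Rightarrow> svir \<Rightarrow> svir \<Rightarrow> svir" where
  "svir_bracket s x y =
     (\<Sum>i \<in> Poly_Mapping.keys x. \<Sum>j \<in> Poly_Mapping.keys y.
        svir_scale (Poly_Mapping.lookup x i * Poly_Mapping.lookup y j) (basis_bracket s i j))"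

subsection \<open>They are Lie superalgebras\<close>

lemma lookup_svir_scale [simp]:
  "Poly_Mapping.lookup (svir_scale a x) i = a * Poly_Mapping.lookup x i"
  by (simp add: svir_scale_def Poly_Mapping.map.rep_eq when_def)

lemma lookup_svir_basis:
  "Poly_Mapping.lookup (svir_basis i) j = (if i = j then 1 else 0)"
  by (simp add: svir_basis_def lookup_single when_def)

interpretation svir: vector_space svir_scale
  by standard (auto intro!: poly_mapping_eqI simp: lookup_add algebra_simps)

lemma svir_part_iff:
  "x \<in> svir_part p \<longleftrightarrow> (\<forall>i. parity i \<noteq> p \<longrightarrow> Poly_Mapping.lookup x i = 0)"
  by (auto simp: svir_part_def in_keys_iff)

lemma svir_subspace_part: "svir.subspace (svir_part p)"
  by (auto simp: svir.subspace_def svir_part_iff lookup_add)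

lemma svir_expand:
  assumes "finite A" "Poly_Mapping.keys x \<subseteq> A"
  shows "x = (\<Sum>i\<in>A. svir_scale (Poly_Mapping.lookup x i) (svir_basis i))"
proof (rule poly_mapping_eqI)
  fix j
  show "Poly_Mapping.lookup x j =
    Poly_Mapping.lookup (\<Sum>i\<in>A. svir_scale (Poly_Mapping.lookup x i) (svir_basis i)) j"
    using assms by (auto simp: lookup_sum lookup_svir_basis if_distrib in_keys_iff cong: if_cong)
qed

lemma svir_bracket_superset:
  assumes "finite A" "Poly_Mapping.keys x \<subseteq> A" "finite B" "Poly_Mapping.keys y \<subseteq> B"
  shows "svir_bracket s x y = (\<Sum>i\<in>A. \<Sum>j\<in>B.
    svir_scale (Poly_Mapping.lookup x i * Poly_Mapping.lookup y j) (basis_bracket s i j))"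
proof -
  have "svir_bracket s x y = (\<Sum>i \<in> Poly_Mapping.keys x. \<Sum>j\<in>B.
    svir_scale (Poly_Mapping.lookup x i * Poly_Mapping.lookup y j) (basis_bracket s i j))"
    unfolding svir_bracket_def
    by (intro sum.cong refl sum.mono_neutral_left) (use assms in \<open>auto simp: in_keys_iff\<close>)
  also have "\<dots> = (\<Sum>i\<in>A. \<Sum>j\<in>B.
    svir_scale (Poly_Mapping.lookup x i * Poly_Mapping.lookup y j) (basis_bracket s i j))"
    by (intro sum.mono_neutral_left) (use assms in \<open>auto simp: in_keys_iff\<close>)
  finally show ?thesis .
qed

lemma svir_bracket_add_left:
  "svir_bracket s (x + x') y = svir_bracket s x y + svir_bracket s x' y"
proof -
  let ?A = "Poly_Mapping.keys x \<union> Poly_Mapping.keys x'" and ?B = "Poly_Mapping.keys y"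
  have fA: "finite ?A" and fB: "finite ?B" by auto
  show ?thesis
    by (subst (1 2 3) svir_bracket_superset[OF fA _ fB])
      (use keys_add[of x x'] in
        \<open>auto simp: lookup_add sum.distrib algebra_simps svir.scale_left_distrib\<close>)
qed

lemma svir_bracket_add_right:
  "svir_bracket s x (y + y') = svir_bracket s x y + svir_bracket s x y'"
proof -
  let ?B = "Poly_Mapping.keys y \<union> Poly_Mapping.keys y'" and ?A = "Poly_Mapping.keys x"
  have fA: "finite ?A" and fB: "finite ?B" by auto
  show ?thesis
    by (subst (1 2 3) svir_bracket_superset[OF fA _ fB])
      (use keys_add[of y y'] in
        \<open>auto simp: lookup_add sum.distrib algebra_simps svir.scale_left_distrib\<close>)
qed

lemma svir_bracket_scale_left:
  "svir_bracket s (svir_scale a x) y = svir_scale a (svir_bracket s x y)"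
proof -
  let ?A = "Poly_Mapping.keys x" and ?B = "Poly_Mapping.keys y"
  have fA: "finite ?A" and fB: "finite ?B" by auto
  show ?thesis
    by (subst (1 2) svir_bracket_superset[OF fA _ fB])
      (auto simp: svir.scale_sum_right algebra_simps in_keys_iff)
qed

lemma svir_bracket_scale_right:
  "svir_bracket s x (svir_scale a y) = svir_scale a (svir_bracket s x y)"
proof -
  let ?A = "Poly_Mapping.keys x" and ?B = "Poly_Mapping.keys y"
  have fA: "finite ?A" and fB: "finite ?B" by auto
  show ?thesis
    by (subst (1 2) svir_bracket_superset[OF fA _ fB])
      (auto simp: svir.scale_sum_right algebra_simps in_keys_iff)
qed

lemma linear_svir_bracket_right:
  "Vector_Spaces.linear svir_scale svir_scale (svir_bracket s x)"
  by unfold_locales (simp_all add: svir_bracket_add_right svir_bracket_scale_right)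

lemma linear_svir_bracket_left:
  "Vector_Spaces.linear svir_scale svir_scale (\<lambda>x. svir_bracket s x y)"
  by unfold_locales (simp_all add: svir_bracket_add_left svir_bracket_scale_left)

lemma svir_bracket_zero [simp]: "svir_bracket s 0 y = 0" "svir_bracket s x 0 = 0"
  by (simp_all add: svir_bracket_def)

lemma svir_bracket_uminus:
  "svir_bracket s (- x) y = - svir_bracket s x y"
  "svir_bracket s x (- y) = - svir_bracket s x y"
  by (metis add.right_inverse minus_unique svir_bracket_add_left svir_bracket_zero(1))
     (metis add.right_inverse minus_unique svir_bracket_add_right svir_bracket_zero(2))

lemma svir_bracket_basis [simp]:
  "svir_bracket s (svir_basis i) (svir_basis j) = basis_bracket s i j"
  by (simp add: svir_bracket_def svir_basis_def)

lemma svir_part_induct [consumes 1, case_names zero add scale basis]: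
  assumes "x \<in> svir_part p"
    and "P 0"
    and "\<And>x y. P x \<Longrightarrow> P y \<Longrightarrow> P (x + y)"
    and "\<And>a x. P x \<Longrightarrow> P (svir_scale a x)"
    and "\<And>i. parity i = p \<Longrightarrow> P (svir_basis i)"
  shows "P x"
proof -
  let ?f = "\<lambda>i. svir_scale (Poly_Mapping.lookup x i) (svir_basis i)"
  have "P (sum ?f A)" if "finite A" "A \<subseteq> Poly_Mapping.keys x" for A
    using that by (induction A) (use assms in \<open>auto simp: svir_part_def\<close>)
  then have "P (sum ?f (Poly_Mapping.keys x))" by simp
  then show ?thesis using svir_expand[of "Poly_Mapping.keys x" x] by simp
qed

lemma svir_graded:
  assumes "x \<in> svir_part p" "y \<in> svir_part q"
  shows "svir_bracket s x y \<in> svir_part (p + q)"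
  using assms(1)
proof (induction x rule: svir_part_induct)
  case (basis i)
  show ?case using assms(2)
  proof (induction y rule: svir_part_induct)
    case (basis j)
    with \<open>parity i = p\<close> show ?case
      by (cases i; cases j)
        (auto simp: svir_part_iff lookup_svir_basis lookup_add split: if_splits)
  qed (use svir_subspace_part[of "p + q"] in
      \<open>auto simp: svir.subspace_def svir_bracket_add_right svir_bracket_scale_right\<close>)
qed (use svir_subspace_part[of "p + q"] in
    \<open>auto simp: svir.subspace_def svir_bracket_add_left svir_bracket_scale_left\<close>)

lemma mode_square:
  assumes "k + l + twice_offset s = 0"
  shows "(mode s k)\<^sup>2 = (mode s l)\<^sup>2"
proof -
  have "of_int (k + l + twice_offset s) = (0::complex)"
    using assms by simp
  then have "mode s k = - mode s l"
    unfolding mode_def by (simp add: eq_neg_iff_add_eq_0 algebra_simps)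
  then show ?thesis by simp
qed

lemma svir_super_skew:
  assumes "x \<in> svir_part p" "y \<in> svir_part q"
  shows "svir_bracket s x y = - svir_scale (koszul_sign p q) (svir_bracket s y x)"
  using assms(1)
proof (induction x rule: svir_part_induct)
  case (basis i)
  show ?case using assms(2)
  proof (induction y rule: svir_part_induct)
    case (basis j)
    with \<open>parity i = p\<close> show ?case
      by (cases i; cases j; intro poly_mapping_eqI)
        (auto simp: koszul_sign_def lookup_svir_basis lookup_add lookup_minus add_eq_0_iff
          add.commute mode_square field_simps)
  qed (simp_all add: svir_bracket_add_right svir_bracket_scale_right svir_bracket_add_left
      svir_bracket_scale_left algebra_simps)
qed (simp_all add: svir_bracket_add_right svir_bracket_scale_right svir_bracket_add_left
      svir_bracket_scale_left algebra_simps)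

lemma mode_add: "mode s (m + k) = of_int m + mode s k"
  by (simp add: mode_def)

lemma int_sum_zeroD: "a + b = 0 \<Longrightarrow> a = - b" for a b :: int
  by simp

lemmas svir_bracket_simps =
  svir_bracket_add_left svir_bracket_add_right svir_bracket_scale_left svir_bracket_scale_right
  svir_bracket_uminus

lemma svir_super_jacobi_basis:
  "svir_bracket s (svir_basis i) (basis_bracket s j k) =
     svir_bracket s (basis_bracket s i j) (svir_basis k) +
     svir_scale (koszul_sign (parity i) (parity j))
       (svir_bracket s (svir_basis j) (basis_bracket s i k))"
  apply (cases i; cases j; cases k; rule poly_mapping_eqI)
  apply (simp_all add: svir_bracket_simps koszul_sign_def lookup_svir_basis lookup_add
      lookup_minus mode_add ac_simps)
  apply (auto dest!: int_sum_zeroD)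
  apply (simp_all add: mode_def field_simps power2_eq_square power3_eq_cube)
  done

lemma svir_super_jacobi:
  assumes "x \<in> svir_part p" "y \<in> svir_part q" "z \<in> svir_part r"
  shows "svir_bracket s x (svir_bracket s y z) =
    svir_bracket s (svir_bracket s x y) z +
    svir_scale (koszul_sign p q) (svir_bracket s y (svir_bracket s x z))"
  using assms(1)
proof (induction x rule: svir_part_induct)
  case (basis i)
  note i = basis
  show ?case using assms(2)
  proof (induction y rule: svir_part_induct)
    case (basis j)
    note j = basis
    show ?case using assms(3)
    proof (induction z rule: svir_part_induct)
      case (basis k)
      show ?case using i j svir_super_jacobi_basis[of s i j k] by simp
    qed (simp_all add: svir_bracket_simps algebra_simps)
  qed (simp_all add: svir_bracket_simps algebra_simps)
qed (simp_all add: svir_bracket_simps algebra_simps)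

lemma svir_part_sum: "\<exists>x\<in>svir_part 0. \<exists>y\<in>svir_part 1. v = x + y"
proof -
  let ?K = "Poly_Mapping.keys v"
  let ?f = "\<lambda>i. svir_scale (Poly_Mapping.lookup v i) (svir_basis i)"
  let ?h = "\<lambda>p. sum ?f {i \<in> ?K. parity i = p}"
  have h: "?h p \<in> svir_part p" for p
    by (rule svir.subspace_sum[OF svir_subspace_part])
      (auto simp: svir_part_iff lookup_svir_basis)
  have "?K = {i \<in> ?K. parity i = 0} \<union> {i \<in> ?K. parity i = 1}"
    by auto
  moreover have "sum ?f ({i \<in> ?K. parity i = 0} \<union> {i \<in> ?K. parity i = 1}) = ?h 0 + ?h 1"
    by (rule sum.union_disjoint) auto
  ultimately have "v = ?h 0 + ?h 1"
    using svir_expand[of ?K v] by simp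
  then show ?thesis using h by blast
qed

interpretation svir: lie_superalgebra svir_scale svir_part "svir_bracket s" for s
proof unfold_locales
  show "svir_part 0 \<inter> svir_part 1 = {0}"
    by (auto simp: svir_part_def)
qed (fact svir_subspace_part svir_part_sum svir_bracket_add_left svir_bracket_add_right
    svir_bracket_scale_left svir_bracket_scale_right svir_graded svir_super_skew
    svir_super_jacobi)+

end

theory Submission
  imports Defs
begin

text \<open>
  Multiplication by a homogeneous element \<open>z\<close> is a superderivation up to a factor: it satisfies
  \<open>2 D[x,y] = [D x,y] \<plusminus> [x,D y]\<close>. The factor \<open>2\<close> makes this far more rigid than the ordinary
  Leibniz rule. The proof has two steps.

  First, if \<open>z\<close> is odd then \<open>D\<close> vanishes (\<open>odd_half_superderivation.eq_zero\<close>). Comparing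
  coefficients of basis vectors in the rule gives a linear recurrence for the coefficients of \<open>D L\<^sub>m\<close>. Its instances
  at \<open>(m,0)\<close> express all of them by those of \<open>D L\<^sub>0\<close>, up to resonances, and the instance at
  \<open>(n,-n)\<close> then forces \<open>D L\<^sub>0 = 0\<close>. Once \<open>D\<close> kills every \<open>L\<^sub>m\<close>, the brackets \<open>[G\<^sub>r,G\<^sub>s]\<close> and
  \<open>[L\<^sub>m,G\<^sub>r]\<close> give \<open>D G\<^sub>r = 0\<close>.

  Second, the even elements need no such analysis. If \<open>z\<close> is even and \<open>x\<close> is odd, then
  \<open>z x = x z = 0\<close> by supercommutativity and the first step. So \<open>D\<close> kills the odd part, hence by the
  rule also every bracket of two odd elements; such brackets span the even part
  (\<open>linear_eq_zero_on_even_part\<close>), so \<open>D = 0\<close>.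
\<close>

section \<open>Coefficients of brackets with a generator\<close>

lemma svir_induct [case_names zero add scale basis]:
  assumes "P 0"
    and "\<And>x y. P x \<Longrightarrow> P y \<Longrightarrow> P (x + y)"
    and "\<And>a x. P x \<Longrightarrow> P (svir_scale a x)"
    and "\<And>i. P (svir_basis i)"
  shows "P x"
proof -
  have "P y" if "y \<in> svir_part p" for y p
    using that by (induction y rule: svir_part_induct) (use assms in auto)
  then show ?thesis
    using svir_part_sum[of x] assms(2) by blast
qed

lemma svir_basis_in_part [simp]: "svir_basis i \<in> svir_part p \<longleftrightarrow> parity i = p"
  by (auto simp: svir_part_iff lookup_svir_basis)

text \<open>
  A relation between brackets becomes a scalar recurrence by reading off one coefficient. The
  coefficients recorded here are those to which only one coefficient of \<open>x\<close> contributes.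
\<close>

lemma lookup_bracket_L_right_at_G:
  "Poly_Mapping.lookup (svir_bracket s x (svir_basis (L n))) (G l) =
     (mode s (l - n) - of_int n / 2) * Poly_Mapping.lookup x (G (l - n))"
proof (induction x rule: svir_induct)
  case (basis i)
  show ?case
    by (cases i) (auto simp: lookup_svir_basis lookup_add lookup_minus)
qed (simp_all add: svir_bracket_simps lookup_add distrib_left mult.left_commute)

lemma lookup_bracket_L_left_at_G:
  "Poly_Mapping.lookup (svir_bracket s (svir_basis (L m)) x) (G l) =
     (of_int m / 2 - mode s (l - m)) * Poly_Mapping.lookup x (G (l - m))"
proof (induction x rule: svir_induct)
  case (basis i)
  show ?case
    by (cases i) (auto simp: lookup_svir_basis lookup_add lookup_minus)
qed (simp_all add: svir_bracket_simps lookup_add distrib_left mult.left_commute)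

lemma lookup_bracket_L_left_at_C:
  "Poly_Mapping.lookup (svir_bracket s (svir_basis (L m)) x) C =
     of_int (m ^ 3 - m) / 12 * Poly_Mapping.lookup x (L (- m))"
proof (induction x rule: svir_induct)
  case (basis i)
  show ?case
    by (cases i) (auto simp: lookup_svir_basis lookup_add lookup_minus)
qed (simp_all only: svir_bracket_simps svir_bracket_zero lookup_add lookup_svir_scale lookup_zero
    distrib_left mult_zero_right mult.left_commute)

lemma lookup_bracket_G_right_at_L:
  "Poly_Mapping.lookup (svir_bracket s x (svir_basis (G n))) (L l) =
     2 * Poly_Mapping.lookup x (G (l - n - twice_offset s))"
proof (induction x rule: svir_induct)
  case (basis i)
  show ?case
    by (cases i) (auto simp: lookup_svir_basis lookup_add lookup_minus)
qed (simp_all add: svir_bracket_simps lookup_add distrib_left mult.left_commute)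

lemma lookup_bracket_G_right_at_G:
  "Poly_Mapping.lookup (svir_bracket s x (svir_basis (G n))) (G l) =
     (of_int (l - n) / 2 - mode s n) * Poly_Mapping.lookup x (L (l - n))"
proof (induction x rule: svir_induct)
  case (basis i)
  show ?case
    by (cases i) (auto simp: lookup_svir_basis lookup_add lookup_minus)
qed (simp_all add: svir_bracket_simps lookup_add distrib_left mult.left_commute)

lemma lookup_bracket_G_left_at_G:
  "Poly_Mapping.lookup (svir_bracket s (svir_basis (G n)) x) (G l) =
     - (of_int (l - n) / 2 - mode s n) * Poly_Mapping.lookup x (L (l - n))"
proof (induction x rule: svir_induct)
  case (basis i)
  show ?case
    by (cases i) (auto simp: lookup_svir_basis lookup_add lookup_minus)
qed (simp_all add: svir_bracket_simps lookup_add distrib_left mult.left_commute)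

section \<open>Odd half-superderivations vanish\<close>

text \<open>
  The rule abstracts multiplication by an odd element of a transposed Poisson superalgebra: the
  sign is the one produced by moving an operator of parity \<open>1\<close> past \<open>x\<close>.
\<close>

locale odd_half_superderivation = Vector_Spaces.linear svir_scale svir_scale D
  for s :: sector and D :: "svir \<Rightarrow> svir" +
  assumes odd: "x \<in> svir_part p \<Longrightarrow> D x \<in> svir_part (p + 1)"
    and half_leibniz: "x \<in> svir_part p \<Longrightarrow> y \<in> svir_part q \<Longrightarrow>
      svir_scale 2 (D (svir_bracket s x y)) =
        svir_bracket s (D x) y + svir_scale (koszul_sign p 1) (svir_bracket s x (D y))"
begin

text \<open>
  Since \<open>C\<close> is central, so is \<open>D C\<close>; but the centre is even and \<open>D C\<close> is odd.
\<close>

lemma D_C: "D (svir_basis C) = 0"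
proof (rule poly_mapping_eqI)
  fix j
  have oddC: "D (svir_basis C) \<in> svir_part 1"
    using odd[of "svir_basis C" 0] by simp
  show "Poly_Mapping.lookup (D (svir_basis C)) j = Poly_Mapping.lookup 0 j"
  proof (cases j)
    case (G k)
    have [simp]: "svir_bracket s (svir_basis C) x = 0" for x
    proof (induction x rule: svir_induct)
      case (basis i) show ?case by (cases i) auto
    qed (simp_all add: svir_bracket_simps)
    have "svir_bracket s (D (svir_basis C)) (svir_basis (G 0)) = 0"
      using half_leibniz[of "svir_basis C" 0 "svir_basis (G 0)" 1] by (simp add: zero)
    then show ?thesis
      using lookup_bracket_G_right_at_L[of s "D (svir_basis C)" 0 "k + twice_offset s"] G by simp
  qed (use oddC in \<open>auto simp: svir_part_iff\<close>)
qed

text \<open>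
  Fix a degree \<open>\<tau>\<close> and let \<open>g n\<close> be the coefficient of \<open>D L\<^sub>n\<close> at \<open>G\<close> of mode \<open>n + \<tau>\<close>. The rule for
  \<open>[L\<^sub>m,L\<^sub>n]\<close> relates \<open>g m\<close>, \<open>g n\<close> and \<open>g (m + n)\<close>. With \<open>n = 0\<close> it determines \<open>g m\<close> from \<open>g 0\<close>
  except at the resonance \<open>m = \<tau>\<close>; with \<open>(n,-n)\<close> it reduces to \<open>4 n\<^sup>3 g 0 = (3/2) n\<^sup>3 g 0\<close>, so that
  \<open>g 0 = 0\<close>. A resonant value with \<open>\<tau> \<noteq> 0\<close> is reached from
  the others as \<open>\<tau> = 2 \<tau> - \<tau>\<close>.
\<close>

lemma D_L: "D (svir_basis (L m)) = 0"
proof -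
  have oddL: "D (svir_basis (L n)) \<in> svir_part 1" for n
    using odd[of "svir_basis (L n)" 0] by simp
  have "Poly_Mapping.lookup (D (svir_basis (L m))) (G l) = 0" for m l
  proof -
    define t where "t = l - m"
    define \<tau> where "\<tau> = mode s t"
    define g where "g = (\<lambda>n. Poly_Mapping.lookup (D (svir_basis (L n))) (G (n + t)))"
    have rec: "2 * (of_int (m - n)) * g (m + n) =
        (of_int m + \<tau> - of_int n / 2) * g m + (of_int m / 2 - of_int n - \<tau>) * g n" for m n
    proof -
      have "D (svir_bracket s (svir_basis (L m)) (svir_basis (L n))) =
        svir_scale (of_int (m - n)) (D (svir_basis (L (m + n))))"
        by (simp only: svir_bracket_basis basis_bracket.simps add scale D_C
            svir.scale_zero_right add_0_right)
      then have "svir_scale 2 (svir_scale (of_int (m - n)) (D (svir_basis (L (m + n))))) =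
        svir_bracket s (D (svir_basis (L m))) (svir_basis (L n)) +
        svir_bracket s (svir_basis (L m)) (D (svir_basis (L n)))"
        using half_leibniz[of "svir_basis (L m)" 0 "svir_basis (L n)" 0]
        by (simp add: koszul_sign_def)
      from arg_cong[OF this, of "\<lambda>x. Poly_Mapping.lookup x (G (m + n + t))"]
      show ?thesis
        by (simp add: lookup_add lookup_minus lookup_bracket_L_right_at_G
            lookup_bracket_L_left_at_G g_def \<tau>_def mode_def algebra_simps)
    qed
    have g_rel: "(of_int n - \<tau>) * g n = (of_int n / 2 - \<tau>) * g 0" for n
      using rec[of n 0] by (simp add: field_simps)
    have g0: "g 0 = 0"
    proof -
      \<comment> \<open>This is larger than \<open>\<bar>\<tau>\<bar> \<le> \<bar>t\<bar> + 1/2\<close>, so neither \<open>n\<close> nor \<open>-n\<close> is resonant.\<close>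
      define n where "n = \<bar>t\<bar> + 2"
      have twice: "of_int (2 * t + twice_offset s) = 2 * \<tau>"
        by (simp add: \<tau>_def mode_def)
      have "2 * n \<noteq> 2 * t + twice_offset s" "2 * n \<noteq> - (2 * t + twice_offset s)" "n \<noteq> 0"
        by (cases s; simp add: n_def)+
      then have "of_int (2 * n) \<noteq> 2 * \<tau>" "of_int (2 * n) \<noteq> - (2 * \<tau>)" "n \<noteq> 0"
        unfolding twice[symmetric] of_int_minus[symmetric] of_int_eq_iff by auto
      then have n: "of_int n \<noteq> \<tau>" "of_int n \<noteq> - \<tau>" "n \<noteq> 0"
        by auto
      let ?n = "of_int n :: complex"
      have "4 * ?n * g 0 = (3 / 2 * ?n + \<tau>) * g n + (3 / 2 * ?n - \<tau>) * g (- n)"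
        using rec[of n "- n"] by (simp add: field_simps)
      then have "4 * ?n * g 0 * ((?n - \<tau>) * (?n + \<tau>)) =
          (3 / 2 * ?n + \<tau>) * (?n + \<tau>) * ((?n - \<tau>) * g n) -
          (3 / 2 * ?n - \<tau>) * (?n - \<tau>) * ((- ?n - \<tau>) * g (- n))"
        by algebra
      also have "\<dots> = (3 / 2 * ?n + \<tau>) * (?n + \<tau>) * ((?n / 2 - \<tau>) * g 0) -
          (3 / 2 * ?n - \<tau>) * (?n - \<tau>) * ((- ?n / 2 - \<tau>) * g 0)"
        using g_rel[of n] g_rel[of "- n"] by simp
      finally have *: "4 * ?n * g 0 * ((?n - \<tau>) * (?n + \<tau>)) =
          (3 / 2 * ?n + \<tau>) * (?n + \<tau>) * ((?n / 2 - \<tau>) * g 0) -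
          (3 / 2 * ?n - \<tau>) * (?n - \<tau>) * ((- ?n / 2 - \<tau>) * g 0)" .
      have "5 / 2 * ?n ^ 3 * g 0 = 4 * ?n * g 0 * ((?n - \<tau>) * (?n + \<tau>)) -
          ((3 / 2 * ?n + \<tau>) * (?n + \<tau>) * ((?n / 2 - \<tau>) * g 0) -
           (3 / 2 * ?n - \<tau>) * (?n - \<tau>) * ((- ?n / 2 - \<tau>) * g 0))"
        by (simp add: field_simps power2_eq_square power3_eq_cube)
      with * have "5 / 2 * ?n ^ 3 * g 0 = 0"
        by simp
      then show ?thesis
        using n by simp
    qed
    have g_off: "g n = 0" if "of_int n \<noteq> \<tau>" for n
      using g_rel[of n] g0 that by simp
    have "g m = 0"
    proof (cases "of_int m = \<tau>")
      case True
      show ?thesis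
      proof (cases "m = 0")
        case False
        have "of_int (2 * m) \<noteq> \<tau>" "of_int (- m) \<noteq> \<tau>"
          using False True[symmetric] by auto
        then show ?thesis
          using rec[of "2 * m" "- m"] False g_off[of "2 * m"] g_off[of "- m"] by simp
      qed (use g0 in simp)
    qed (rule g_off)
    then show ?thesis
      by (simp add: g_def t_def)
  qed
  then show ?thesis
    using oddL[of m]
    by (intro poly_mapping_eqI) (metis svir_part_iff lookup_zero parity.elims zero_neq_one)
qed

text \<open>
  As \<open>D\<close> kills the even part, the rule for \<open>[G\<^sub>r,G\<^sub>r]\<close> confines the \<open>L\<close>-part of \<open>D G\<^sub>r\<close> to a multiple
  of \<open>L\<close> of index \<open>2 r\<close>, which commutes with \<open>G\<^sub>r\<close> but not with \<open>G\<^bsub>r+1\<^esub>\<close>; the rule for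
  \<open>[G\<^sub>r,G\<^bsub>r+1\<^esub>]\<close> eliminates it. What is left of \<open>D G\<^sub>r\<close> is central, so \<open>2 D[L\<^sub>m,G\<^sub>r] = [L\<^sub>m,D G\<^sub>r] = 0\<close>.
\<close>

lemma D_G: "D (svir_basis (G k)) = 0"
proof -
  define c where "c = (\<lambda>k l. Poly_Mapping.lookup (D (svir_basis (G k))) (L l))"
  have rel: "(of_int l / 2 - mode s n) * c k l +
      (of_int (l + n - k) / 2 - mode s k) * c n (l + n - k) = 0" for k n l
  proof -
    have "svir_bracket s (D (svir_basis (G k))) (svir_basis (G n)) -
        svir_bracket s (svir_basis (G k)) (D (svir_basis (G n))) = 0"
      using half_leibniz[of "svir_basis (G k)" 1 "svir_basis (G n)" 1]
      by (simp add: koszul_sign_def add scale D_C D_L)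
    from arg_cong[OF this, of "\<lambda>x. Poly_Mapping.lookup x (G (l + n))"]
    show ?thesis
      by (simp add: lookup_minus lookup_bracket_G_right_at_G lookup_bracket_G_left_at_G c_def
          algebra_simps)
  qed
  have off: "c k l = 0" if "of_int l / 2 \<noteq> mode s k" for k l
    using rel[of l k k] that by simp
  have c0: "c k l = 0" for k l
  proof (cases "of_int l / 2 = mode s k")
    case True
    have "c (k + 1) (l + 1) = 0"
      by (rule off) (use True in \<open>simp add: mode_def field_simps\<close>)
    with rel[of l "k + 1" k] True show ?thesis
      by (simp add: mode_def)
  qed (rule off)
  have central: "(of_int m / 2 - mode s k) * Poly_Mapping.lookup (D (svir_basis (G (m + k)))) C = 0"
    for m k
  proof -
    have "svir_scale 2 (D (svir_bracket s (svir_basis (L m)) (svir_basis (G k)))) =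
        svir_bracket s (svir_basis (L m)) (D (svir_basis (G k)))"
      using half_leibniz[of "svir_basis (L m)" 0 "svir_basis (G k)" 1]
      by (simp add: koszul_sign_def D_L)
    from arg_cong[OF this, of "\<lambda>x. Poly_Mapping.lookup x C"] show ?thesis
      using c0[of k "- m"] by (simp add: scale lookup_bracket_L_left_at_C c_def mult.commute)
  qed
  \<comment> \<open>The factors \<open>-r\<close> and \<open>3/2 - r\<close> from \<open>[L\<^sub>0,G\<^sub>r]\<close> and \<open>[L\<^sub>1,G\<^bsub>r-1\<^esub>]\<close> have no common zero.\<close>
  have "Poly_Mapping.lookup (D (svir_basis (G k))) C = 0"
    using central[of 0 k] central[of 1 "k - 1"] by (auto simp: mode_def field_simps)
  moreover have "D (svir_basis (G k)) \<in> svir_part 0"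
    using odd[of "svir_basis (G k)" 1] by simp
  ultimately show ?thesis
    using c0[of k] unfolding c_def
    by (intro poly_mapping_eqI) (metis svir_part_iff lookup_zero parity.elims zero_neq_one)
qed

theorem eq_zero: "D x = 0"
proof (induction x rule: svir_induct)
  case (basis i)
  show ?case by (cases i) (simp_all add: D_C D_L D_G)
qed (simp_all add: zero add scale)

end

section \<open>Vanishing of the product\<close>

text \<open>
  The brackets \<open>[G\<^sub>r,G\<^sub>s]\<close> span the even part. For \<open>r + s = p \<noteq> 0\<close> they give \<open>2 L\<^sub>p\<close>; for \<open>r + s = 0\<close>
  the coefficient of \<open>C\<close> varies with \<open>r\<^sup>2\<close>, so two different \<open>r\<close> separate \<open>L\<^sub>0\<close> from \<open>C\<close>.
\<close>

lemma linear_eq_zero_on_even_part: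
  assumes "Vector_Spaces.linear svir_scale svir_scale D"
    and vanish: "\<And>x y. x \<in> svir_part 1 \<Longrightarrow> y \<in> svir_part 1 \<Longrightarrow> D (svir_bracket s x y) = 0"
    and "x \<in> svir_part 0"
  shows "D x = 0"
proof -
  interpret Vector_Spaces.linear svir_scale svir_scale D by fact
  have GG: "svir_scale 2 (D (svir_basis (L (k + l + twice_offset s)))) +
     svir_scale (if k + l + twice_offset s = 0 then ((mode s k)\<^sup>2 - 1 / 4) / 3 else 0)
       (D (svir_basis C)) = 0" for k l
    using vanish[of "svir_basis (G k)" "svir_basis (G l)"] by (simp add: add scale)
  have L0: "svir_scale 2 (D (svir_basis (L 0))) +
      svir_scale (((mode s k)\<^sup>2 - 1 / 4) / 3) (D (svir_basis C)) = 0" for k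
    using GG[of k "- k - twice_offset s"] by simp
  have "svir_scale (((mode s 1)\<^sup>2 - 1 / 4) / 3 - ((mode s 0)\<^sup>2 - 1 / 4) / 3)
      (D (svir_basis C)) = 0"
    unfolding svir.scale_left_diff_distrib using L0[of 0] L0[of 1]
    by (metis add_left_cancel right_minus_eq)
  moreover have "(mode s 1)\<^sup>2 - (mode s 0)\<^sup>2 \<noteq> 0"
    by (cases s) (simp_all add: mode_def power2_eq_square)
  ultimately have C: "D (svir_basis C) = 0"
    by simp
  have L: "D (svir_basis (L p)) = 0" for p
    using GG[of 0 "p - twice_offset s"] by (simp add: C)
  show ?thesis
    using assms(3)
  proof (induction x rule: svir_part_induct)
    case (basis i)
    then show ?case by (cases i) (simp_all add: C L)
  qed (simp_all add: zero add scale)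
qed

theorem corollary30:
  fixes s :: sector
  shows "\<not> (\<exists>mult. transposed_poisson_superalgebra svir_scale svir_part (svir_bracket s) mult \<and>
           nontrivial_structure (svir_bracket s) mult)"
proof -
  have "mult x y = 0"
    if "transposed_poisson_superalgebra svir_scale svir_part (svir_bracket s) mult" for mult x y
  proof -
    interpret tp: transposed_poisson_superalgebra svir_scale svir_part "svir_bracket s" mult
      by (fact that)
    have odd_left: "mult z x = 0" if z: "z \<in> svir_part 1" for z x
    proof -
      interpret Vector_Spaces.linear svir_scale svir_scale "mult z"
        by (rule tp.prod.linear_right)
      interpret odd_half_superderivation s "mult z"
      proof
        show "mult z x \<in> svir_part (p + 1)" if "x \<in> svir_part p" for x p
          using tp.prod.graded[OF z that] by (simp add: add.commute)
      qed (use tp.transposed_leibniz z in blast)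
      show ?thesis by (rule eq_zero)
    qed
    have odd_right: "mult z x = 0" if "z \<in> svir_part 0" "x \<in> svir_part 1" for z x
      using tp.prod.super_comm[OF that] odd_left[OF that(2)] by simp
    have even_even: "mult z x = 0" if z: "z \<in> svir_part 0" and x: "x \<in> svir_part 0" for z x
    proof (rule linear_eq_zero_on_even_part[OF tp.prod.linear_right _ x])
      fix u v assume uv: "u \<in> svir_part 1" "v \<in> svir_part 1"
      show "mult z (svir_bracket s u v) = 0"
        using tp.transposed_leibniz[OF uv z] odd_right[OF z] uv by simp
    qed
    obtain x0 x1 y0 y1 where "x0 \<in> svir_part 0" "x1 \<in> svir_part 1" "x = x0 + x1"
      "y0 \<in> svir_part 0" "y1 \<in> svir_part 1" "y = y0 + y1"
      using svir_part_sum by metis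
    moreover have "mult (a + b) c = mult a c + mult b c"
      "mult c (a + b) = mult c a + mult c b" for a b c
      using tp.prod.linear_left[of c] tp.prod.linear_right[of c]
      by (auto simp: Vector_Spaces.linear_iff)
    ultimately show ?thesis
      using odd_left odd_right even_even by simp
  qed
  then show ?thesis
    unfolding nontrivial_structure_def by blast
qed

end
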